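(* Let $p\ge 5$ be a prime and $n$ a positive integer. Then $a_2(pn)\equiv 0\pmod{p^2}$, where $$a_2(N)=\sum_{k=0}^{\lfloor (N-2)/3\rfloor}(-1)^{N-k}\binom{3k+2}{k}\binom{2k+2}{k}\binom{N}{3k+2}\binom{N+k}{k}3^{N-3k-2}.$$ *)

theory Defs
  imports "HOL-Number_Theory.Number_Theory"
begin

(* The range bound uses truncated subtraction and agrees with floor ((N - 2) / 3) for N >= 2.
   For N < 2 the index range degenerates to {0} instead of being empty, but that one summand
   vanishes because N choose 2 = 0.  Within the range, 3 * k + 2 <= N whenever N >= 2, so the
   exponents N - k and N - 3 * k - 2 are not truncated. *)
definition a2 :: "nat \<Rightarrow> int" where
  "a2 N = (\<Sum>k = 0..(N - 2) div 3.
     (-1) ^ (N - k) * int ((3 * k + 2) choose k) * int ((2 * k + 2) choose k)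
       * int (N choose (3 * k + 2)) * int ((N + k) choose k) * 3 ^ (N - 3 * k - 2))"

end

theory Submission
  imports Defs
begin

text \<open>Up to sign and a power of 3, the summand is the multinomial coefficient
  \<open>(N+k)! / ((N-3k-2)! k!^3 (k+2)!)\<close>. For \<open>N = pn\<close> and \<open>k = pj + i\<close> with \<open>0 \<le> i < p\<close>, its \<open>p\<close>-adic
  valuation is at least the carry out of the last base-\<open>p\<close> digit of the lower entries, which is 1 if
  \<open>3i + 2 \<le> p\<close> and at least 2 otherwise. In the former case, Wilson's theorem shows that the summand is
  \<open>p\<close> times, modulo \<open>p\<close>, a factor depending only on \<open>j\<close> times \<open>(3i+1)! / (27^i i!^2 (i+2)!)\<close>. Summing
  these over \<open>i \<le> m = floor((p-2)/3)\<close> telescopes to a multiple of \<open>(3m+4)!\<close>, and \<open>p \<le> 3m + 4\<close>.\<close>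

section \<open>Factorials modulo a prime\<close>

text \<open>The multiples of \<open>p\<close> among the factors contribute
  \<open>p ^ A * A!\<close>. Each run of \<open>p - 1\<close> factors between consecutive multiples
  is \<open>-1\<close> modulo \<open>p\<close> by Wilson's theorem, and the last \<open>r\<close>
  factors reduce to \<open>r!\<close>.\<close>

lemma fact_prime_split:
  fixes p :: nat
  assumes p: "prime p" and r: "r < p"
  shows "\<exists>u::int. fact (p * A + r) = int p ^ A * fact A * u \<and> [u = (-1) ^ A * fact r] (mod int p)"
  using r
proof (induction A arbitrary: r)
  case 0
  then show ?case by (intro exI[of _ "fact r"]) simp
next
  case (Suc A)
  from Suc.prems show ?case
  proof (induction r)
    case 0
    have "p - 1 < p" using 0 by simp
    from Suc.IH[OF this] obtain u :: int where
      u: "fact (p * A + (p - 1)) = int p ^ A * fact A * u" "[u = (-1) ^ A * fact (p - 1)] (mod int p)"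
      by blast
    have e: "p * Suc A + 0 = Suc (p * A + (p - 1))" using 0 by simp
    have "(fact (p * Suc A + 0) :: int) = int (p * Suc A) * fact (p * A + (p - 1))"
      unfolding e fact_Suc using e by simp
    then have "(fact (p * Suc A + 0) :: int) = int p ^ Suc A * fact (Suc A) * u"
      unfolding u(1) by (simp add: algebra_simps)
    moreover have "[u = (-1) ^ Suc A * fact 0] (mod int p)"
      using cong_trans[OF u(2) cong_mult[OF cong_refl wilson_theorem[OF p]]] by simp
    ultimately show ?case by blast
  next
    case (Suc r)
    then obtain u :: int where
      u: "fact (p * Suc A + r) = int p ^ Suc A * fact (Suc A) * u" "[u = (-1) ^ Suc A * fact r] (mod int p)"
      by auto
    have "(fact (p * Suc A + Suc r) :: int) = int (p * Suc A + Suc r) * fact (p * Suc A + r)"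
      by (simp only: add_Suc_right fact_Suc of_nat_id)
    then have "(fact (p * Suc A + Suc r) :: int)
        = int p ^ Suc A * fact (Suc A) * (u * int (p * Suc A + Suc r))"
      unfolding u(1) by (simp only: ac_simps)
    moreover have "[u * int (p * Suc A + Suc r) = (-1) ^ Suc A * fact r * int (Suc r)] (mod int p)"
      by (intro cong_mult u(2)) (simp add: cong_iff_dvd_diff)
    then have "[u * int (p * Suc A + Suc r) = (-1) ^ Suc A * fact (Suc r)] (mod int p)"
      by (simp only: fact_Suc of_nat_id ac_simps)
    ultimately show ?case by blast
  qed
qed

lemma coprime_fact_prime:
  fixes p :: nat
  assumes "prime p" "r < p"
  shows "coprime (int p) (fact r)"
proof -
  have "\<not> p dvd fact r" using assms by (simp add: prime_dvd_fact_iff)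
  then have "coprime p (fact r)" using assms(1) by (simp add: prime_imp_coprime)
  then show ?thesis by (metis coprime_int_iff of_nat_fact)
qed

text \<open>Induction from Wilson's theorem at \<open>r = 0\<close>: the step trades the factor
  \<open>p - 1 - r\<close> for \<open>r + 1\<close>, which is its negative modulo
  \<open>p\<close>.\<close>

lemma wilson_reflection:
  fixes p :: nat
  assumes p: "prime p" and r: "r < p"
  shows "[fact (p - 1 - r) * fact r = (-1) ^ Suc r] (mod int p)"
  using r
proof (induction r)
  case 0
  then show ?case using wilson_theorem[OF p] by simp
next
  case (Suc r)
  define s where "s = p - 1 - Suc r"
  have s: "p - 1 - r = Suc s" "int p = 2 + (int r + int s)"
    using Suc.prems unfolding s_def by auto
  have "[(int (Suc r)) * (fact s * fact r) = (- int (Suc s)) * (fact s * fact r)] (mod int p)"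
    by (intro cong_mult cong_refl) (simp add: s(2) cong_iff_dvd_diff algebra_simps)
  moreover have "(- int (Suc s)) * (fact s * fact r) = - (fact (p - 1 - r) * fact r)"
    unfolding s(1) by (simp add: algebra_simps)
  moreover have "[- (fact (p - 1 - r) * fact r) = - ((-1) ^ Suc r)] (mod int p)"
    using Suc.IH Suc.prems by (subst cong_minus_minus_iff) simp
  ultimately have "[(int (Suc r)) * (fact s * fact r) = (-1) ^ Suc (Suc r)] (mod int p)"
    by (metis cong_trans power_Suc mult_minus1)
  then show ?case unfolding s_def[symmetric] by (simp add: algebra_simps)
qed

section \<open>The multinomial coefficient and its power of \<open>p\<close>\<close>

text \<open>Each of \<open>N!\<close>, \<open>(3k+2)!\<close> and \<open>(2k+2)!\<close> is the
  numerator of one binomial coefficient and a denominator of another, so all three cancel.\<close>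

lemma multinomial_factorials:
  assumes "3 * k + 2 \<le> N"
  shows "((3 * k + 2) choose k) * ((2 * k + 2) choose k) * (N choose (3 * k + 2)) * ((N + k) choose k)
    * (fact (N - 3 * k - 2) * fact k ^ 3 * fact (k + 2)) = (fact (N + k) :: nat)"
proof -
  have h1: "fact k * fact (2 * k + 2) * ((3 * k + 2) choose k) = (fact (3 * k + 2) :: nat)"
    using binomial_fact_lemma[of k "3 * k + 2"] by simp
  have h2: "fact k * fact (k + 2) * ((2 * k + 2) choose k) = (fact (2 * k + 2) :: nat)"
    using binomial_fact_lemma[of k "2 * k + 2"] by simp
  have h3: "fact (3 * k + 2) * fact (N - 3 * k - 2) * (N choose (3 * k + 2)) = (fact N :: nat)"
    using binomial_fact_lemma[OF assms] by (simp only: diff_diff_left)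
  have h4: "fact k * fact N * ((N + k) choose k) = (fact (N + k) :: nat)"
    using binomial_fact_lemma[of k "N + k"] by simp
  show ?thesis
    unfolding h4[symmetric] h3[symmetric] h1[symmetric] h2[symmetric]
    by (simp only: power3_eq_cube ac_simps)
qed

text \<open>The unit parts of the factorials carry the multinomial coefficient modulo \<open>p\<close>; the power of
  \<open>p\<close> that splits off is the carry \<open>c\<close> out of the last base-\<open>p\<close> digit.\<close>

lemma multinomial_prime_split:
  fixes p :: nat and X :: int
  assumes p: "prime p"
    and X: "X * (fact (p * B1 + r1) * fact (p * B2 + r2) ^ 3 * fact (p * B3 + r3)) = fact (p * A + r)"
    and r: "r < p" "r1 < p" "r2 < p" "r3 < p"
    and A: "A = B1 + 3 * B2 + B3 + c"
  shows "\<exists>Y. X = int p ^ c * Y \<and>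
    [Y * ((-1) ^ (B1 + 3 * B2 + B3) * (fact r1 * fact r2 ^ 3 * fact r3))
      = fact A div (fact B1 * fact B2 ^ 3 * fact B3) * ((-1) ^ A * fact r)] (mod int p)"
proof -
  have p0: "int p \<noteq> 0" using p by auto
  obtain u where u: "(fact (p * A + r) :: int) = int p ^ A * fact A * u"
    "[u = (-1) ^ A * fact r] (mod int p)" using fact_prime_split[OF p r(1)] by blast
  obtain v1 where v1: "(fact (p * B1 + r1) :: int) = int p ^ B1 * fact B1 * v1"
    "[v1 = (-1) ^ B1 * fact r1] (mod int p)" using fact_prime_split[OF p r(2)] by blast
  obtain v2 where v2: "(fact (p * B2 + r2) :: int) = int p ^ B2 * fact B2 * v2"
    "[v2 = (-1) ^ B2 * fact r2] (mod int p)" using fact_prime_split[OF p r(3)] by blast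
  obtain v3 where v3: "(fact (p * B3 + r3) :: int) = int p ^ B3 * fact B3 * v3"
    "[v3 = (-1) ^ B3 * fact r3] (mod int p)" using fact_prime_split[OF p r(4)] by blast
  define F where "F = (fact B1 * fact B2 ^ 3 * fact B3 :: int)"
  define q where "q = fact A div F"
  define v where "v = v1 * v2 ^ 3 * v3"
  \<comment> \<open>The quotient \<open>q\<close> is exact because \<open>B1 + 3 * B2 + B3\<close>
    is at most \<open>A\<close>.\<close>
  have "F = fact B1 * ((fact B2 * (fact B2 * fact B2)) * fact B3)"
    unfolding F_def by (simp add: power3_eq_cube ac_simps)
  also have "\<dots> dvd fact B1 * (fact (B2 + (B2 + B2)) * fact B3)"
    by (intro mult_dvd_mono dvd_refl dvd_trans[OF _ fact_fact_dvd_fact] fact_fact_dvd_fact)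
  also have "\<dots> dvd fact (B1 + (B2 + (B2 + B2) + B3))"
    by (intro dvd_trans[OF _ fact_fact_dvd_fact] mult_dvd_mono dvd_refl fact_fact_dvd_fact)
  also have "\<dots> dvd fact A" by (intro fact_dvd) (simp add: A)
  finally have "fact A = F * q" unfolding q_def by simp
  have "F \<noteq> 0" unfolding F_def by simp
  have "X * (int p ^ (B1 + 3 * B2 + B3) * F * v) = int p ^ (B1 + 3 * B2 + B3 + c) * (F * q) * u"
    using X unfolding u(1) v1(1) v2(1) v3(1) \<open>fact A = F * q\<close>[symmetric] unfolding A[symmetric]
    by (simp add: F_def v_def power_mult_distrib power_add power_mult ac_simps flip: power_mult)
  then have "(int p ^ (B1 + 3 * B2 + B3) * F) * (X * v)
      = (int p ^ (B1 + 3 * B2 + B3) * F) * (int p ^ c * (q * u))"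
    by (simp add: power_add algebra_simps)
  then have Xv: "X * v = int p ^ c * (q * u)" using p0 \<open>F \<noteq> 0\<close> by simp
  have vc: "[v = ((-1) ^ B1 * fact r1) * ((-1) ^ B2 * fact r2) ^ 3 * ((-1) ^ B3 * fact r3)] (mod int p)"
    unfolding v_def by (intro cong_mult cong_pow v1(2) v2(2) v3(2))
  \<comment> \<open>All last digits are below \<open>p\<close>, so \<open>v\<close> is a unit modulo
    \<open>p\<close> and the whole factor \<open>p ^ c\<close> must divide \<open>X\<close>.\<close>
  have "coprime (int p) (((-1) ^ B1 * fact r1) * ((-1) ^ B2 * fact r2) ^ 3 * ((-1) ^ B3 * fact r3))"
    using coprime_fact_prime[OF p r(2)] coprime_fact_prime[OF p r(3)] coprime_fact_prime[OF p r(4)]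
    by simp
  then have "coprime (int p) v"
    using cong_imp_coprime[OF cong_sym[OF vc]] by (simp add: coprime_commute)
  then have "coprime (int p ^ c) v" by simp
  moreover have "int p ^ c dvd X * v" unfolding Xv by simp
  ultimately have "int p ^ c dvd X" by (simp add: coprime_dvd_mult_left_iff)
  then obtain Y where Y: "X = int p ^ c * Y" by blast
  have "Y * v = q * u" using Xv p0 unfolding Y by simp
  moreover have "[Y * v = Y * (((-1) ^ B1 * fact r1) * ((-1) ^ B2 * fact r2) ^ 3
      * ((-1) ^ B3 * fact r3))] (mod int p)"
    by (intro cong_mult cong_refl vc)
  moreover have "[q * u = q * ((-1) ^ A * fact r)] (mod int p)"
    by (intro cong_mult cong_refl u(2))
  ultimately have "[Y * (((-1) ^ B1 * fact r1) * ((-1) ^ B2 * fact r2) ^ 3 * ((-1) ^ B3 * fact r3))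
      = q * ((-1) ^ A * fact r)] (mod int p)"
    by (metis cong_sym cong_trans)
  then show ?thesis using Y unfolding q_def F_def
    by (intro exI[of _ Y]) (simp add: power_mult_distrib power_add ac_simps flip: power_mult)
qed

text \<open>Over a field this reads
  \<open>(\<Sum>i\<le>m. (3i+1)! / (27^i i!^2 (i+2)!)) = (3m+4)! / (24 \<cdot> 27^m m! (m+1)! (m+2)!)\<close>, the partial sums of
  a hypergeometric series \<open>2F1(2/3, 4/3; 3; 1)\<close>, which telescopes because \<open>3 = 2/3 + 4/3 + 1\<close>.\<close>

lemma telescoping_cong:
  fixes Z :: "nat \<Rightarrow> int"
  assumes "\<And>i. i \<le> m \<Longrightarrow> [Z i * (fact i ^ 2 * fact (i + 2)) = z * fact (3 * i + 1)] (mod q)"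
  shows "[24 * (fact m * fact (m + 1) * fact (m + 2)) * (\<Sum>i\<le>m. 27 ^ (m - i) * Z i)
    = z * fact (3 * m + 4)] (mod q)"
  using assms
proof (induction m)
  case 0
  have "[24 * (Z 0 * (fact 0 ^ 2 * fact (0 + 2))) = 24 * (z * fact (3 * 0 + 1))] (mod q)"
    by (intro cong_mult cong_refl 0) simp
  then show ?case by (simp add: fact_numeral algebra_simps)
next
  case (Suc m)
  define P where "P = (\<Sum>i\<le>m. 27 ^ (m - i) * Z i)"
  define f :: int where "f = fact m"
  define g :: int where "g = fact (3 * m + 4)"
  define x where "x = int m"
  have IH: "[24 * (fact m * fact (m + 1) * fact (m + 2)) * P = z * g] (mod q)"
    unfolding P_def g_def using Suc by simp
  have Zc: "[Z (Suc m) * (fact (Suc m) ^ 2 * fact (Suc m + 2)) = z * fact (3 * Suc m + 1)] (mod q)"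
    by (rule Suc.prems) simp
  have "(\<Sum>i\<le>Suc m. 27 ^ (Suc m - i) * Z i) = 27 * P + Z (Suc m)"
    unfolding P_def by (simp add: sum_distrib_left Suc_diff_le mult.assoc)
  moreover have f1: "fact (Suc m) = (x + 1) * f" "fact (m + 1) = (x + 1) * f"
    "fact (m + 2) = (x + 2) * (x + 1) * f" "fact (Suc m + 1) = (x + 2) * (x + 1) * f"
    "fact (Suc m + 2) = (x + 3) * (x + 2) * (x + 1) * f"
    unfolding f_def x_def by (simp_all add: algebra_simps)
  moreover have g1: "fact (3 * Suc m + 1) = g"
    unfolding g_def by (rule arg_cong[of _ _ fact]) simp
  moreover have g2: "fact (3 * Suc m + 4) = (3 * x + 7) * (3 * x + 6) * (3 * x + 5) * g"
  proof -
    have "3 * Suc m + 4 = Suc (Suc (Suc (3 * m + 4)))" by simp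
    then show ?thesis unfolding g_def x_def by (simp only: fact_Suc) (simp add: algebra_simps)
  qed
  \<comment> \<open>The weights are the factors missing from \<open>24 (m+1)! (m+2)! (m+3)!\<close>
    in each of the two terms. The induction closes by
    \<open>27 (x+1) (x+3) + 24 = 3 (3x+5) (3x+7)\<close>.\<close>
  moreover have "[27 * (x + 1) * (x + 2) * (x + 3) * (24 * (fact m * fact (m + 1) * fact (m + 2)) * P)
       + 24 * (x + 2) * (Z (Suc m) * (fact (Suc m) ^ 2 * fact (Suc m + 2)))
     = 27 * (x + 1) * (x + 2) * (x + 3) * (z * g) + 24 * (x + 2) * (z * fact (3 * Suc m + 1))] (mod q)"
    by (intro cong_add cong_mult cong_refl IH Zc)
  ultimately show ?case
    unfolding f1 g1 g2 f_def[symmetric] by (simp only:) (simp add: algebra_simps power2_eq_square)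
qed

section \<open>Single terms of the sum\<close>

text \<open>The multinomial coefficient of \<open>N + k\<close> over \<open>N - 3k - 2\<close>,
  \<open>k\<close>, \<open>k\<close>, \<open>k\<close>, \<open>k + 2\<close>. The binomial form
  makes it vanish when \<open>3k + 2 > N\<close>.\<close>

definition a2_multinomial :: "nat \<Rightarrow> nat \<Rightarrow> int" where
  "a2_multinomial N k = int (((3 * k + 2) choose k) * ((2 * k + 2) choose k)
     * (N choose (3 * k + 2)) * ((N + k) choose k))"

text \<open>For \<open>N = p * n\<close> the longer range splits evenly into \<open>n\<close> blocks
  of length \<open>p\<close>; the added terms vanish.\<close>

lemma a2_conv_sum_lessThan:
  assumes "N \<ge> 2"
  shows "a2 N = (\<Sum>k<N. (-1) ^ (N - k) * 3 ^ (N - 3 * k - 2) * a2_multinomial N k)"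
proof -
  have "a2 N = (\<Sum>k = 0..(N - 2) div 3. (-1) ^ (N - k) * 3 ^ (N - 3 * k - 2) * a2_multinomial N k)"
    unfolding a2_def a2_multinomial_def by (intro sum.cong) (simp_all add: ac_simps)
  also have "\<dots> = (\<Sum>k<N. (-1) ^ (N - k) * 3 ^ (N - 3 * k - 2) * a2_multinomial N k)"
  proof (intro sum.mono_neutral_left ballI)
    show "{0..(N - 2) div 3} \<subseteq> {..<N}" using assms by auto
    fix k assume "k \<in> {..<N} - {0..(N - 2) div 3}"
    then have "N < 3 * k + 2" using assms by auto
    then show "(-1) ^ (N - k) * 3 ^ (N - 3 * k - 2) * a2_multinomial N k = 0"
      by (simp add: a2_multinomial_def binomial_eq_0)
  qed simp
  finally show ?thesis .
qed

lemma a2_multinomial_dvd: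
  fixes p n :: nat
  assumes p: "prime p" "p \<ge> 5" and i: "i < p" "p < 3 * i + 2"
  shows "(int p)\<^sup>2 dvd a2_multinomial (p * n) (p * j + i)"
proof (cases "3 * (p * j + i) + 2 \<le> p * n")
  case False
  then show ?thesis by (simp add: a2_multinomial_def binomial_eq_0)
next
  case True
  define k where "k = p * j + i"
  define b where "b = p * n - 3 * k - 2"
  define B1 where "B1 = b div p"
  define B3 where "B3 = (k + 2) div p"
  have p0: "p > 0" using p by simp
  have dm: "p * B1 + b mod p = b" "p * B3 + (k + 2) mod p = k + 2"
    unfolding B1_def B3_def by simp_all
  have "b + 3 * k + 2 = p * n" using True unfolding b_def k_def by simp
  then have bb: "b + (3 * i + 2) + p * (3 * j) = p * n" unfolding k_def by (simp add: algebra_simps)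
  \<comment> \<open>Equivalently, the carry \<open>n + j - (B1 + 3 * j + B3)\<close> is at least
    2.\<close>
  have "B1 + B3 + 2 * j + 2 \<le> n"
  proof (cases "i + 2 < p")
    case True
    then have "B3 = j" unfolding B3_def k_def by (simp add: div_nat_eqI)
    have "p * (B1 + 1 + 3 * j) < p * n"
      using bb dm(1) i(2) by (simp add: algebra_simps)
    then have "B1 + 1 + 3 * j < n" by (simp only: mult_less_cancel1)
    then show ?thesis using \<open>B3 = j\<close> by simp
  next
    case False
    \<comment> \<open>Here \<open>k + 2\<close> wraps around, so \<open>B1\<close> must be smaller
      by one more. This follows from \<open>3 * i + 2 >= 3 * p - 4 > 2 * p\<close>, using
      \<open>p >= 5\<close>.\<close>
    then have "B3 = j + 1"
      unfolding B3_def k_def using i p by (intro div_nat_eqI) (auto simp: algebra_simps)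
    have "p * (B1 + 2 + 3 * j) < p * n"
      using bb dm(1) False p by (simp add: algebra_simps)
    then have "B1 + 2 + 3 * j < n" by (simp only: mult_less_cancel1)
    then show ?thesis using \<open>B3 = j + 1\<close> by simp
  qed
  then obtain d where d: "n = B1 + B3 + 2 * j + 2 + d" using le_Suc_ex by blast
  have X: "a2_multinomial (p * n) k * (fact (p * B1 + b mod p) * fact (p * j + i) ^ 3
      * fact (p * B3 + (k + 2) mod p)) = fact (p * (n + j) + i)"
  proof -
    have "a2_multinomial (p * n) k * (fact b * fact k ^ 3 * fact (k + 2)) = fact (p * n + k)"
      unfolding a2_multinomial_def b_def
      using arg_cong[OF multinomial_factorials[of k "p * n"], of int] True
      unfolding k_def[symmetric] by (simp only: of_nat_mult of_nat_power of_nat_fact)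
    then show ?thesis unfolding dm by (simp add: k_def algebra_simps)
  qed
  obtain Y where "a2_multinomial (p * n) k = int p ^ (2 + d) * Y"
    using multinomial_prime_split[OF p(1) X i(1) _ i(1), of "2 + d"] p0 d by auto
  then show ?thesis unfolding k_def by (simp add: power_add power2_eq_square mult.assoc)
qed

text \<open>The last digits \<open>p - 3i - 2\<close>, \<open>i\<close>, \<open>i\<close>,
  \<open>i\<close>, \<open>i + 2\<close> add up to \<open>p + i\<close>, so the carry is exactly 1.
  Wilson reflection then turns division by \<open>(p - 3i - 2)!\<close> into multiplication by
  \<open>(3i+1)!\<close>, up to sign.\<close>

lemma a2_multinomial_cong:
  fixes p n :: nat
  assumes p: "prime p" "p \<ge> 5" and i: "3 * i + 2 \<le> p" and j: "3 * j < n"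
  shows "\<exists>Y. a2_multinomial (p * n) (p * j + i) = int p * Y \<and>
    [(-1) ^ i * Y * (fact i ^ 2 * fact (i + 2))
      = - (fact (n + j) div (fact (n - 3 * j - 1) * fact j ^ 3 * fact j)) * fact (3 * i + 1)] (mod int p)"
proof -
  define k where "k = p * j + i"
  define B where "B = n - 3 * j - 1"
  define r where "r = p - (3 * i + 2)"
  define q where "q = (fact (n + j) div (fact B * fact j ^ 3 * fact j) :: int)"
  have n: "n = B + 1 + 3 * j" using j unfolding B_def by simp
  have r: "p = r + (3 * i + 2)" using i unfolding r_def by simp
  have pn: "p * n = p * B + r + 3 * k + 2"
  proof -
    have "p * n = p * B + 3 * (p * j) + p" unfolding n by (simp add: algebra_simps)
    also have "\<dots> = p * B + 3 * (p * j) + (r + (3 * i + 2))" by (rule arg_cong[OF r])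
    finally show ?thesis unfolding k_def by simp
  qed
  then have b: "p * n - 3 * k - 2 = p * B + r" by simp
  have X: "a2_multinomial (p * n) k * (fact (p * B + r) * fact (p * j + i) ^ 3 * fact (p * j + (i + 2)))
      = fact (p * (n + j) + i)"
  proof -
    have "a2_multinomial (p * n) k * (fact (p * B + r) * fact k ^ 3 * fact (k + 2)) = fact (p * n + k)"
      unfolding a2_multinomial_def b[symmetric]
      using arg_cong[OF multinomial_factorials[of k "p * n"], of int] pn
      by (simp only: of_nat_mult of_nat_power of_nat_fact)
    then show ?thesis by (simp add: k_def algebra_simps)
  qed
  have l: "i < p" "r < p" "i + 2 < p" "3 * i + 1 < p" using i p r by linarith+
  have "n + j = B + 3 * j + j + 1" using n by simp
  from multinomial_prime_split[OF p(1) X l(1,2,1,3) this] obtain Y where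
    Y: "a2_multinomial (p * n) k = int p * Y" and
    c: "[Y * ((-1) ^ (B + 3 * j + j) * (fact r * fact i ^ 3 * fact (i + 2)))
      = q * ((-1) ^ (n + j) * fact i)] (mod int p)"
    unfolding q_def by auto
  \<comment> \<open>The carry 1 makes \<open>n + j\<close> and \<open>B + 3 * j + j\<close> differ
    in parity, so the two signs are opposite; multiplying by \<open>- e\<close> clears both.\<close>
  define e where "e = ((-1) ^ (n + j) :: int)"
  have "(-1 :: int) ^ (B + 3 * j + j) = - e" unfolding e_def n by (simp add: power_add)
  moreover have "e * e = 1" unfolding e_def by (simp flip: power_add)
  ultimately have c2: "[Y * fact r * fact i ^ 2 * fact (i + 2) * fact i = - q * fact i] (mod int p)"
  proof -
    have "Y * (- e * (fact r * fact i ^ 3 * fact (i + 2))) * - e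
        = (e * e) * (Y * fact r * fact i ^ 2 * fact (i + 2) * fact i)"
      by (simp only: power3_eq_cube power2_eq_square mult_minus_left mult_minus_right minus_minus ac_simps)
    moreover have "q * (e * fact i) * - e = (e * e) * (- q * fact i)"
      by (simp only: mult_minus_left mult_minus_right ac_simps)
    ultimately show ?thesis
      using cong_mult[OF c cong_refl[of "- e"]] \<open>e * e = 1\<close>
        \<open>(-1) ^ (B + 3 * j + j) = - e\<close>
      by (simp only: e_def[symmetric] mult_1)
  qed
  have "coprime (fact i) (int p)" using coprime_fact_prime[OF p(1) l(1)] by (simp add: coprime_commute)
  then have c3: "[Y * fact r * fact i ^ 2 * fact (i + 2) = - q] (mod int p)"
    using c2 by (simp only: cong_mult_rcancel)
  have "p - 1 - (3 * i + 1) = r" using r by simp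
  then have w: "[fact r * fact (3 * i + 1) = (-1) ^ i] (mod int p)"
    using wilson_reflection[OF p(1) l(4)] by (simp add: power_mult)
  have "[(Y * fact i ^ 2 * fact (i + 2)) * (fact r * fact (3 * i + 1))
      = (Y * fact i ^ 2 * fact (i + 2)) * (-1) ^ i] (mod int p)"
    by (intro cong_mult cong_refl w)
  moreover have "[(Y * fact r * fact i ^ 2 * fact (i + 2)) * fact (3 * i + 1)
      = - q * fact (3 * i + 1)] (mod int p)"
    by (intro cong_mult cong_refl c3)
  moreover have "(Y * fact i ^ 2 * fact (i + 2)) * (fact r * fact (3 * i + 1))
      = (Y * fact r * fact i ^ 2 * fact (i + 2)) * fact (3 * i + 1)"
    by (simp only: ac_simps)
  moreover have "(Y * fact i ^ 2 * fact (i + 2)) * (-1) ^ i = (-1) ^ i * Y * (fact i ^ 2 * fact (i + 2))"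
    by (simp only: ac_simps)
  ultimately have "[(-1) ^ i * Y * (fact i ^ 2 * fact (i + 2)) = - q * fact (3 * i + 1)] (mod int p)"
    by (metis cong_sym cong_trans)
  then show ?thesis using Y unfolding k_def q_def B_def by blast
qed

section \<open>Summation over blocks of length \<open>p\<close>\<close>

lemma a2_block_dvd:
  fixes p n j :: nat
  assumes p: "prime p" "p \<ge> 5"
  defines "N \<equiv> p * n"
  shows "(int p)\<^sup>2 dvd (\<Sum>i<p. (-1) ^ (N - (p * j + i)) * 3 ^ (N - 3 * (p * j + i) - 2)
    * a2_multinomial N (p * j + i))" (is "_ dvd (\<Sum>i<p. ?t i)")
proof (cases "3 * j < n")
  case False
  then have "p * n \<le> 3 * (p * j)" using mult_le_mono2[of n "3 * j" p] by (simp add: mult.left_commute)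
  then have "N < 3 * (p * j + i) + 2" for i
    unfolding N_def using add_mult_distrib2[of 3 "p * j" i] by linarith
  then have "a2_multinomial N (p * j + i) = 0" for i
    by (simp add: a2_multinomial_def binomial_eq_0)
  then show ?thesis by simp
next
  case True
  \<comment> \<open>The largest \<open>i\<close> with \<open>3 * i + 2 <= p\<close>: terms beyond it
    are divisible by \<open>p^2\<close> one by one, those up to it only after summation by
    telescoping.\<close>
  define m where "m = (p - 2) div 3"
  have m: "3 * m + 2 \<le> p" "p \<le> 3 * m + 4" using p unfolding m_def by presburger+
  define q where "q = (fact (n + j) div (fact (n - 3 * j - 1) * fact j ^ 3 * fact j) :: int)"
  have "\<forall>i\<in>{..m}. \<exists>Y. a2_multinomial N (p * j + i) = int p * Y \<and>
    [(-1) ^ i * Y * (fact i ^ 2 * fact (i + 2)) = - q * fact (3 * i + 1)] (mod int p)"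
    unfolding N_def q_def using m by (intro ballI a2_multinomial_cong p True) auto
  from bchoice[OF this] obtain Y where
    Y: "\<And>i. i \<le> m \<Longrightarrow> a2_multinomial N (p * j + i) = int p * Y i" and
    Yc: "\<And>i. i \<le> m \<Longrightarrow> [(-1) ^ i * Y i * (fact i ^ 2 * fact (i + 2)) = - q * fact (3 * i + 1)] (mod int p)"
    by auto
  have "p * (3 * j + 1) \<le> p * n" using True by (intro mult_le_mono2) simp
  then have le: "p + 3 * (p * j) \<le> N" unfolding N_def by (simp add: algebra_simps)
  \<comment> \<open>The factor common to all \<open>i <= m\<close>: the sign from
    \<open>i = 0\<close> and the lowest power of 3, from \<open>i = m\<close>. By \<open>le\<close>,
    no exponent is truncated.\<close>
  define s where "s = (-1 :: int) ^ (N - p * j) * 3 ^ (N - 3 * (p * j + m) - 2)"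
  define Z where "Z i = s * ((-1) ^ i * Y i)" for i
  have t: "?t i = int p * (27 ^ (m - i) * Z i)" if "i \<le> m" for i
  proof -
    have "N - p * j = (N - (p * j + i)) + i" using le m that by simp
    then have "(-1 :: int) ^ (N - (p * j + i)) = (-1) ^ (N - p * j) * (-1) ^ i"
      by (simp add: power_add mult.assoc flip: power_mult_distrib)
    moreover have "N - 3 * (p * j + i) - 2 = (N - 3 * (p * j + m) - 2) + 3 * (m - i)"
      using le m that by simp
    then have "(3 :: int) ^ (N - 3 * (p * j + i) - 2) = 3 ^ (N - 3 * (p * j + m) - 2) * 27 ^ (m - i)"
      by (simp add: power_add power_mult)
    ultimately show ?thesis unfolding Y[OF that] Z_def s_def by (simp only: ac_simps)
  qed
  define S where "S = (\<Sum>i\<le>m. 27 ^ (m - i) * Z i)"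
  have "[24 * (fact m * fact (m + 1) * fact (m + 2)) * S = (s * - q) * fact (3 * m + 4)] (mod int p)"
    unfolding S_def
  proof (rule telescoping_cong)
    fix i assume "i \<le> m"
    from cong_mult[OF cong_refl[of s] Yc[OF this]]
    show "[Z i * (fact i ^ 2 * fact (i + 2)) = (s * - q) * fact (3 * i + 1)] (mod int p)"
      unfolding Z_def by (simp only: ac_simps)
  qed
  moreover have "int p dvd fact (3 * m + 4)"
  proof -
    have "p dvd fact (3 * m + 4)" using p(1) m(2) by (simp add: prime_dvd_fact_iff)
    then show ?thesis by (metis int_dvd_int_iff of_nat_fact)
  qed
  ultimately have "int p dvd 24 * (fact m * fact (m + 1) * fact (m + 2)) * S"
    by (meson cong_dvd_iff dvd_mult)
  \<comment> \<open>\<open>24\<close> is \<open>fact 4\<close>, a unit modulo \<open>p\<close>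
    because \<open>p >= 5\<close>; the other factorials are units because
    \<open>m + 2 < p\<close>.\<close>
  moreover have "coprime (int p) (24 * (fact m * fact (m + 1) * fact (m + 2)))"
  proof -
    have "coprime (int p) (fact 4)" "coprime (int p) (fact m)" "coprime (int p) (fact (m + 1))"
      "coprime (int p) (fact (m + 2))"
      using m(1) p by (auto simp del: fact_Suc intro!: coprime_fact_prime)
    moreover have "(fact 4 :: int) = 24" by (simp add: fact_numeral)
    ultimately show ?thesis by (simp only: coprime_mult_right_iff)
  qed
  ultimately have "int p dvd S" by (simp add: coprime_dvd_mult_right_iff)
  moreover have "(\<Sum>i\<le>m. ?t i) = int p * S"
    unfolding S_def sum_distrib_left by (intro sum.cong refl t) simp
  ultimately have low: "(int p)\<^sup>2 dvd (\<Sum>i\<le>m. ?t i)"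
    by (simp add: power2_eq_square mult_dvd_mono)
  have high: "(int p)\<^sup>2 dvd (\<Sum>i\<in>{..<p} - {..m}. ?t i)"
    unfolding N_def using m
    by (intro dvd_sum dvd_mult a2_multinomial_dvd p) (auto simp: m_def)
  have "{..m} \<subseteq> {..<p}" using m by auto
  then have "(\<Sum>i<p. ?t i) = (\<Sum>i\<in>{..<p} - {..m}. ?t i) + (\<Sum>i\<le>m. ?t i)"
    by (intro sum.subset_diff) simp_all
  then show ?thesis using low high by simp
qed

theorem theorem3p2:
  fixes p n :: nat
  assumes "prime p" and "p \<ge> 5" and "n \<ge> 1"
  shows "[a2 (p * n) = 0] (mod (int p)\<^sup>2)"
proof -
  define t where "t k = (-1) ^ (p * n - k) * 3 ^ (p * n - 3 * k - 2) * a2_multinomial (p * n) k" for k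
  have "p * 1 \<le> p * n" using assms(3) by (intro mult_le_mono2)
  then have "p * n \<ge> 2" using assms(2) by linarith
  then have "a2 (p * n) = sum t {..<n * p}"
    unfolding t_def by (simp only: a2_conv_sum_lessThan mult.commute[of n p])
  also have "\<dots> = (\<Sum>j<n. sum t {j * p..<j * p + p})" by (rule sum.nat_group[symmetric])
  also have "\<dots> = (\<Sum>j<n. \<Sum>i<p. t (p * j + i))"
  proof (rule sum.cong[OF refl])
    fix j
    show "sum t {j * p..<j * p + p} = (\<Sum>i<p. t (p * j + i))"
      using sum.shift_bounds_nat_ivl[of t 0 "j * p" p]
      by (simp add: ac_simps atLeast0LessThan)
  qed
  also have "(int p)\<^sup>2 dvd \<dots>"
    unfolding t_def by (intro dvd_sum a2_block_dvd assms)
  finally show ?thesis by (simp add: cong_0_iff)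
qed

end
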